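(* Let $n$ be a non-negative integer and $m$ an integer with $n+m>0$ and $m-1\le n$. Then $$\sum_{j=0}^{n+m}\sum_{k=0}^{n+m-j}\frac{(-2)^{k+j}}{(n+m+k+j)(n-m+j+2)}\binom{n+m+k+j}{n+m-k-j}\binom{k+j}{j}=\frac{(-1)^{n+m}}{2(n+1)(n+m)}\sum_{k=0}^n(-1)^k\frac{\binom{n+m}{2k}}{\binom nk}.$$ In particular, for $n\ge1$, $$\sum_{j=0}^{n}\sum_{k=0}^{n-j}\frac{(-2)^{k+j}}{(n+k+j)(n+j+2)}\binom{n+k+j}{n-k-j}\binom{k+j}{j}=\frac{(-1)^n}{2n(n+1)}\sum_{k=0}^n(-1)^k\frac{\binom{n}{2k}}{\binom nk},$$ $$\sum_{j=0}^{2n}\sum_{k=0}^{2n-j}\frac{(-2)^{k+j}}{(2n+k+j)(j+2)}\binom{2n+k+j}{2n-k-j}\binom{k+j}{j}=\frac{1}{4n(n+1)}\sum_{k=0}^n(-1)^k\frac{\binom{2n}{2k}}{\binom nk}.$$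
   Context: Binomial coefficients $\binom{a}{b}$ with integers $0\le a<b$ are $0$. *)

theory Defs
  imports Complex_Main
begin

end

theory Submission
  imports Defs "HOL-Analysis.Analysis"
begin

text \<open>
  With \<open>N = n + m\<close> and \<open>p = n - m + 1\<close>, both sides equal \<open>(-1)^N / N\<close> times the
  integral of \<open>x^p T_N(x)\<close> over \<open>[0, 1]\<close>, where \<open>T_N\<close> is the Chebyshev polynomial.
  For the left-hand side write \<open>1 / (p + j + 1)\<close> as the integral of \<open>x^(p + j)\<close>, sum over \<open>j\<close> with
  \<open>k + j = s\<close> fixed to get \<open>(1 + x)^s\<close>, and use the expansion of \<open>T_N(-x)\<close> in powers of \<open>1 + x\<close>.
  For the right-hand side expand \<open>T_N(cos t) = cos (N t)\<close> by de Moivre's formula and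
  integrate termwise; each term is a Beta integral.
\<close>

section \<open>Expansion of \<open>T_N\<close> in powers of \<open>1 + x\<close>\<close>

text \<open>
  The weight \<open>N / (N + s)\<close> in the coefficients of \<open>T_N\<close> is removed by writing
  \<open>T_N(-x)\<close> as the mean of two consecutive values of this sum at \<open>z = - 2 (1 + x)\<close>;
  its three-term recurrence is then a consequence of Pascal's rule.
\<close>
definition cheb_aux :: "nat \<Rightarrow> real \<Rightarrow> real" where
  "cheb_aux N z = (\<Sum>s\<le>N. real ((N + s) choose (2 * s)) * z ^ s)"

text \<open>For \<open>s > N\<close> the lower index \<open>2 * s\<close> exceeds
  \<open>N + s\<close>, so padding adds only zeros. This puts sums of different length on a common
  range.\<close>

lemma cheb_aux_extend:
  assumes "N \<le> M"
  shows "cheb_aux N z = (\<Sum>s\<le>M. real ((N + s) choose (2 * s)) * z ^ s)"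
  unfolding cheb_aux_def using assms by (intro sum.mono_neutral_left) auto

text \<open>Two applications of Pascal's rule: a second difference in the upper index lowers the
  lower index by 2.\<close>

lemma binomial_second_difference:
  "real ((N + 2 + Suc s) choose (2 * Suc s)) + real ((N + Suc s) choose (2 * Suc s))
    = 2 * real ((N + 1 + Suc s) choose (2 * Suc s)) + real ((N + 1 + s) choose (2 * s))"
  by simp

lemma cheb_aux_rec:
  "cheb_aux (N + 2) z = (2 + z) * cheb_aux (N + 1) z - cheb_aux N z"
proof -
  let ?b = "\<lambda>N s. real ((N + s) choose (2 * s))"
  have "cheb_aux (N + 2) z + cheb_aux N z = (\<Sum>s\<le>Suc (N + 1). (?b (N + 2) s + ?b N s) * z ^ s)"
    using cheb_aux_extend[of "N + 2" "Suc (N + 1)" z] cheb_aux_extend[of N "Suc (N + 1)" z]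
    by (simp only: sum.distrib distrib_right)
  \<comment> \<open>The terms with \<open>s = 0\<close> are both 1; splitting them off exposes
    \<open>Suc s\<close>, as the second difference requires.\<close>
  also have "\<dots> = 2 + (\<Sum>s\<le>N + 1. (?b (N + 2) (Suc s) + ?b N (Suc s)) * z ^ Suc s)"
    by (subst sum.atMost_Suc_shift) simp
  also have "\<dots> = 2 + (\<Sum>s\<le>N + 1. (2 * ?b (N + 1) (Suc s) + ?b (N + 1) s) * z ^ Suc s)"
    by (simp only: binomial_second_difference)
  also have "\<dots> = 2 * (1 + (\<Sum>s\<le>N + 1. ?b (N + 1) (Suc s) * z ^ Suc s)) + z * cheb_aux (N + 1) z"
    by (simp add: cheb_aux_def sum.distrib sum_distrib_left algebra_simps
        del: sum.atMost_Suc binomial_Suc_Suc)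
  also have "1 + (\<Sum>s\<le>N + 1. ?b (N + 1) (Suc s) * z ^ Suc s) = cheb_aux (N + 1) z"
    by (subst cheb_aux_extend[of "N + 1" "Suc (N + 1)"], simp, subst sum.atMost_Suc_shift) simp
  finally show ?thesis by (simp add: algebra_simps)
qed

text \<open>At this argument \<open>2 + z = - 2 * cos t\<close>, so the recurrence of
  \<open>cheb_aux\<close> is that of \<open>cos (N * t)\<close> with alternating signs. Stating it
  from \<open>Suc N\<close> on avoids a truncated \<open>N - 1\<close> in the induction.\<close>

lemma cheb_aux_cos:
  "cheb_aux (Suc N) (- 2 * (1 + cos t)) + cheb_aux N (- 2 * (1 + cos t))
    = 2 * (- 1) ^ Suc N * cos (real (Suc N) * t)"
proof (induction N rule: induct_nat_012)
  case 0
  show ?case by (simp add: cheb_aux_def choose_two)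
next
  case 1
  show ?case using cos_double_cos[of t]
    by (simp add: cheb_aux_def numeral_2_eq_2 power2_eq_square algebra_simps)
next
  case (ge2 N)
  let ?z = "- 2 * (1 + cos t)"
  have "cos (real (Suc (Suc (Suc N))) * t) + cos (real (Suc N) * t)
      = 2 * cos t * cos (real (Suc (Suc N)) * t)"
    by (subst cos_plus_cos) (simp add: algebra_simps add_divide_distrib)
  then have c: "cos (real (Suc (Suc (Suc N))) * t)
      = 2 * cos t * cos (real (Suc (Suc N)) * t) - cos (real (Suc N) * t)"
    by simp
  have "cheb_aux (Suc (Suc (Suc N))) ?z + cheb_aux (Suc (Suc N)) ?z
      = (2 + ?z) * (cheb_aux (Suc (Suc N)) ?z + cheb_aux (Suc N) ?z)
        - (cheb_aux (Suc N) ?z + cheb_aux N ?z)"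
    using cheb_aux_rec[of "Suc N" ?z] cheb_aux_rec[of N ?z] by (simp add: algebra_simps)
  also have "\<dots> = 2 * (- 1) ^ Suc (Suc (Suc N)) * cos (real (Suc (Suc (Suc N))) * t)"
    unfolding ge2 c by (simp add: algebra_simps)
  finally show ?case .
qed

text \<open>By absorption the second binomial is \<open>(N - s) / (N + s)\<close> times the first,
  and \<open>1 + (N - s) / (N + s) = 2 * N / (N + s)\<close>.\<close>

lemma half_sum_binomial:
  assumes "N \<ge> 1" "s \<le> N"
  shows "real ((N + s) choose (2 * s)) + real ((N - 1 + s) choose (2 * s))
    = 2 * real N / real (N + s) * real ((N + s) choose (N - s))"
proof -
  have "(N + s - 2 * s) * ((N + s) choose (2 * s)) = (N + s) * ((N + s - 1) choose (2 * s))"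
    by (rule binomial_absorb_comp)
  moreover have "N + s - 2 * s = N - s" "N + s - 1 = N - 1 + s"
    using assms by simp_all
  ultimately have "real (N - s) * real ((N + s) choose (2 * s))
      = real (N + s) * real ((N - 1 + s) choose (2 * s))"
    by (metis of_nat_mult)
  moreover have "(N + s) choose (N - s) = (N + s) choose (2 * s)"
    using assms binomial_symmetric[of "N - s" "N + s"] by (simp add: mult_2)
  moreover have "real N + real s \<noteq> 0" using assms by linarith
  ultimately show ?thesis
    using assms by (simp add: field_simps of_nat_diff)
qed

lemma cheb_expand_one_plus:
  assumes "N \<ge> 1"
  shows "(\<Sum>s\<le>N. (- 2) ^ s / real (N + s) * real ((N + s) choose (N - s)) * (1 + cos t) ^ s)
    = (- 1) ^ N / real N * cos (real N * t)"
proof -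
  let ?z = "- 2 * (1 + cos t)"
  have "2 * real N * (\<Sum>s\<le>N. (- 2) ^ s / real (N + s) * real ((N + s) choose (N - s)) * (1 + cos t) ^ s)
      = (\<Sum>s\<le>N. (2 * real N / real (N + s) * real ((N + s) choose (N - s))) * ?z ^ s)"
    unfolding sum_distrib_left power_mult_distrib by (intro sum.cong) simp_all
  also have "\<dots> = (\<Sum>s\<le>N. (real ((N + s) choose (2 * s)) + real ((N - 1 + s) choose (2 * s))) * ?z ^ s)"
    using assms by (intro sum.cong refl) (simp only: half_sum_binomial atMost_iff)
  also have "\<dots> = cheb_aux N ?z + cheb_aux (N - 1) ?z"
    by (simp only: distrib_right sum.distrib cheb_aux_def[of N] cheb_aux_extend[of "N - 1" N, OF diff_le_self])
  also have "\<dots> = 2 * (- 1) ^ N * cos (real N * t)"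
    using cheb_aux_cos[of "N - 1" t] assms by simp
  finally show ?thesis using assms by (simp add: field_simps)
qed

section \<open>De Moivre expansion of \<open>cos (N t)\<close>\<close>

lemma cos_multiple_expand:
  assumes "N \<le> 2 * n + 1"
  shows "cos (real N * t)
    = (\<Sum>k\<le>n. real (N choose (2 * k)) * (- 1) ^ k * sin t ^ (2 * k) * cos t ^ (N - 2 * k))"
proof -
  let ?f = "\<lambda>j. of_nat (N choose j) * (\<i> * of_real (sin t)) ^ j * of_real (cos t) ^ (N - j)"
  have "cis t = \<i> * of_real (sin t) + of_real (cos t)"
    by (simp add: complex_eq_iff)
  then have "cis (real N * t) = (\<i> * of_real (sin t) + of_real (cos t)) ^ N"
    using Complex.DeMoivre[of t N] by simp
  also have "\<dots> = (\<Sum>j\<le>N. ?f j)"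
    by (rule binomial_ring)
  \<comment> \<open>Zero terms pad the sum to \<open>2 * n + 2\<close> terms, which pair up as even
    and odd indices; the odd ones are purely imaginary.\<close>
  also have "\<dots> = (\<Sum>j\<le>Suc (2 * n). ?f j)"
    using assms by (intro sum.mono_neutral_left) auto
  also have "\<dots> = (\<Sum>k\<le>n. ?f (2 * k) + ?f (Suc (2 * k)))"
    by (rule sum.in_pairs_0)
  finally have "cos (real N * t) = (\<Sum>k\<le>n. Re (?f (2 * k) + ?f (Suc (2 * k))))"
    by (metis Re_sum cis.sel(1))
  also have "\<dots> = (\<Sum>k\<le>n. real (N choose (2 * k)) * (- 1) ^ k * sin t ^ (2 * k) * cos t ^ (N - 2 * k))"
  proof (intro sum.cong refl)
    fix k
    have even: "?f (2 * k)
        = of_real (real (N choose (2 * k)) * (- 1) ^ k * sin t ^ (2 * k) * cos t ^ (N - 2 * k))"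
      by (simp add: power_mult_distrib power_mult power_minus[of "(of_real (sin t))\<^sup>2"])
    have odd: "?f (Suc (2 * k))
        = \<i> * of_real (real (N choose Suc (2 * k)) * (- 1) ^ k * sin t ^ Suc (2 * k) * cos t ^ (N - Suc (2 * k)))"
      by (simp add: power_mult_distrib power_mult power_minus[of "(of_real (sin t))\<^sup>2"])
    show "Re (?f (2 * k) + ?f (Suc (2 * k)))
        = real (N choose (2 * k)) * (- 1) ^ k * sin t ^ (2 * k) * cos t ^ (N - 2 * k)"
      unfolding even odd plus_complex.sel Re_complex_of_real by simp
  qed
  finally show ?thesis .
qed

section \<open>Integrals over the unit interval\<close>

lemma has_integral_power_unit:
  "((\<lambda>x::real. x ^ a) has_integral 1 / real (a + 1)) {0..1}"
proof -
  have "((\<lambda>x::real. x ^ a) has_integral 1 ^ (a + 1) / real (a + 1) - 0 ^ (a + 1) / real (a + 1)) {0..1}"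
  proof (rule fundamental_theorem_of_calculus)
    fix x :: real
    have "((\<lambda>x. x ^ (a + 1) / real (a + 1)) has_real_derivative x ^ a) (at x within {0..1})"
      by (rule DERIV_cdivide[OF DERIV_pow, THEN DERIV_cong]) simp
    then show "((\<lambda>x. x ^ (a + 1) / real (a + 1)) has_vector_derivative x ^ a) (at x within {0..1})"
      by (simp only: has_real_derivative_iff_has_vector_derivative)
  qed simp
  then show ?thesis by simp
qed

text \<open>The value is half of the Beta function at \<open>(a + 1, k + 1)\<close>. Integration by
  parts lowers \<open>k\<close> while raising \<open>a\<close>, hence the induction with
  \<open>a\<close> arbitrary.\<close>

lemma has_integral_beta_square:
  "((\<lambda>x::real. x ^ (2 * a + 1) * (1 - x\<^sup>2) ^ k) has_integral
      1 / (2 * real (a + k + 1) * real ((a + k) choose k))) {0..1}"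
proof (induction k arbitrary: a)
  case 0
  show ?case using has_integral_power_unit[of "2 * a + 1"] by (simp add: algebra_simps)
next
  case (Suc k)
  let ?F = "\<lambda>x::real. x ^ (2 * a + 2) * (1 - x\<^sup>2) ^ Suc k / real (2 * a + 2)"
  let ?g = "\<lambda>x::real. x ^ (2 * a + 1) * (1 - x\<^sup>2) ^ Suc k"
  let ?h = "\<lambda>x::real. x ^ (2 * (a + 1) + 1) * (1 - x\<^sup>2) ^ k"
  let ?c = "real (k + 1) / real (a + 1)"
  \<comment> \<open>The boundary term \<open>?F\<close> vanishes at both 0 and 1, so the integral of
    \<open>?g\<close> is \<open>?c\<close> times that of \<open>?h\<close>.\<close>
  have "((\<lambda>x. ?g x - ?c * ?h x) has_integral ?F 1 - ?F 0) {0..1}"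
  proof (rule fundamental_theorem_of_calculus)
    fix x :: real
    have "(?F has_real_derivative
        (real (2 * a + 2) * x ^ (2 * a + 1) * (1 - x\<^sup>2) ^ Suc k
          + x ^ (2 * a + 2) * (real (Suc k) * (1 - x\<^sup>2) ^ k * (- 2 * x))) / real (2 * a + 2))
        (at x within {0..1})"
      by (rule derivative_eq_intros refl | simp)+
    also have "(real (2 * a + 2) * x ^ (2 * a + 1) * (1 - x\<^sup>2) ^ Suc k
          + x ^ (2 * a + 2) * (real (Suc k) * (1 - x\<^sup>2) ^ k * (- 2 * x))) / real (2 * a + 2)
        = ?g x - ?c * ?h x"
    proof -
      have "real (2 * a + 2) = 2 * real (a + 1)" "real (a + 1) \<noteq> 0" by simp_all
      then show ?thesis by (simp add: divide_simps del: of_nat_add of_nat_Suc)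
    qed
    finally show "(?F has_vector_derivative ?g x - ?c * ?h x) (at x within {0..1})"
      by (simp only: has_real_derivative_iff_has_vector_derivative)
  qed simp
  from has_integral_add[OF this has_integral_mult_right[OF Suc.IH[of "a + 1"], of ?c]]
  have *: "(?g has_integral ?c * (1 / (2 * real (a + 1 + k + 1) * real ((a + 1 + k) choose k)))) {0..1}"
    by (simp add: power2_eq_square)
  have "Suc k * ((a + Suc k) choose Suc k) = (a + 1) * ((a + 1 + k) choose k)"
    using binomial_absorb_comp[of "a + Suc k" k] Suc_times_binomial_eq[of "a + k" k] by (simp add: mult.commute)
  then have "real (k + 1) * real ((a + Suc k) choose Suc k) = real (a + 1) * real ((a + 1 + k) choose k)"
    by (metis of_nat_mult Suc_eq_plus1)
  moreover have "real ((a + Suc k) choose Suc k) \<noteq> 0" "real ((a + 1 + k) choose k) \<noteq> 0"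
    by (simp_all del: binomial_Suc_Suc)
  ultimately have "?c * (1 / (2 * real (a + 1 + k + 1) * real ((a + 1 + k) choose k)))
      = 1 / (2 * real (a + Suc k + 1) * real ((a + Suc k) choose Suc k))"
    by (simp add: divide_simps del: binomial_Suc_Suc)
  then show ?case using * by simp
qed

section \<open>Comparison of the two sums\<close>

lemma sum_triangle_antidiagonal:
  fixes g :: "nat \<Rightarrow> nat \<Rightarrow> 'a::comm_monoid_add"
  shows "(\<Sum>j\<le>N. \<Sum>k\<le>N - j. g j k) = (\<Sum>s\<le>N. \<Sum>j\<le>s. g j (s - j))"
proof -
  have "(\<Sum>j\<le>N. \<Sum>k\<le>N - j. g j k) = (\<Sum>(j, k)\<in>(SIGMA j:{..N}. {..N - j}). g j k)"
    by (rule sum.Sigma) auto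
  also have "(SIGMA j:{..N}. {..N - j}) = {(j, k). j + k \<le> N}"
    by auto
  finally show ?thesis by (simp only: sum.triangle_reindex_eq)
qed

text \<open>Eliminating \<open>m\<close> through \<open>N = n + m\<close> leaves natural numbers
  only: \<open>n - m + 2\<close> becomes \<open>2 * n + 2 - N\<close>, and \<open>m - 1 <= n\<close>
  becomes \<open>N <= 2 * n + 1\<close>, which keeps the subtraction exact.\<close>

lemma cheb_integral_eq:
  assumes N: "N \<ge> 1" "N \<le> 2 * n + 1"
  shows "(\<Sum>j\<le>N. \<Sum>k\<le>N - j.
      (- 2) ^ (k + j) / (real (N + k + j) * real (2 * n + 2 - N + j))
        * real ((N + k + j) choose (N - k - j)) * real ((k + j) choose j))
    = (- 1) ^ N / (2 * (real n + 1) * real N)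
        * (\<Sum>k\<le>n. (- 1) ^ k * (real (N choose (2 * k)) / real (n choose k)))"
    (is "?L = ?R")
proof -
  define p where "p = 2 * n + 1 - N"
  let ?c = "\<lambda>s. (- 2) ^ s / real (N + s) * real ((N + s) choose (N - s))"
  let ?f = "\<lambda>x::real. \<Sum>s\<le>N. ?c s * (\<Sum>j\<le>s. real (s choose j) * x ^ (p + j))"
  let ?g = "\<lambda>x::real. (- 1) ^ N / real N * (\<Sum>k\<le>n. real (N choose (2 * k))
      * (x ^ (2 * (n - k) + 1) * (1 - x\<^sup>2) ^ k) * (- 1) ^ k)"
  have "?L = (\<Sum>s\<le>N. \<Sum>j\<le>s. (- 2) ^ (s - j + j) / (real (N + (s - j) + j) * real (2 * n + 2 - N + j))
        * real ((N + (s - j) + j) choose (N - (s - j) - j)) * real ((s - j + j) choose j))"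
    by (rule sum_triangle_antidiagonal)
  also have "\<dots> = (\<Sum>s\<le>N. ?c s * (\<Sum>j\<le>s. real (s choose j) * (1 / real (p + j + 1))))"
    unfolding sum_distrib_left
  proof (intro sum.cong refl)
    fix s j assume "s \<in> {..N}" "j \<in> {..s}"
    then have "N + (s - j) + j = N + s" "N - (s - j) - j = N - s" "s - j + j = s"
        "2 * n + 2 - N + j = p + j + 1"
      using N by (auto simp: p_def)
    then show "(- 2) ^ (s - j + j) / (real (N + (s - j) + j) * real (2 * n + 2 - N + j))
          * real ((N + (s - j) + j) choose (N - (s - j) - j)) * real ((s - j + j) choose j)
        = ?c s * (real (s choose j) * (1 / real (p + j + 1)))"
      by (simp only:) simp
  qed
  finally have "(?f has_integral ?L) {0..1}"
    by (simp only:) (intro has_integral_sum has_integral_mult_right has_integral_power_unit; simp)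
  moreover have "?f x = ?g x" if x: "x \<in> {0..1}" for x
  proof -
    \<comment> \<open>Both expansions of \<open>T_N\<close> are available only at cosines; every
      point of the unit interval is one.\<close>
    obtain t where t: "x = cos t"
      using x by (metis cos_arccos atLeastAtMost_iff order_trans neg_le_0_iff_le zero_le_one)
    have "?f x = x ^ p * (\<Sum>s\<le>N. ?c s * (1 + x) ^ s)"
      using binomial_ring[of x 1]
      by (simp add: sum_distrib_left power_add mult_ac add.commute)
    also have "\<dots> = (- 1) ^ N / real N * (x ^ p * cos (real N * t))"
      using cheb_expand_one_plus[OF N(1), of t] by (simp add: t)
    also have "x ^ p * cos (real N * t)
        = (\<Sum>k\<le>n. real (N choose (2 * k)) * (x ^ (2 * (n - k) + 1) * (1 - x\<^sup>2) ^ k) * (- 1) ^ k)"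
      unfolding cos_multiple_expand[OF N(2)] sum_distrib_left
    proof (intro sum.cong refl)
      fix k assume k: "k \<in> {..n}"
      have s: "sin t ^ (2 * k) = (1 - x\<^sup>2) ^ k"
        by (simp add: t power_mult sin_squared_eq)
      show "x ^ p * (real (N choose (2 * k)) * (- 1) ^ k * sin t ^ (2 * k) * cos t ^ (N - 2 * k))
          = real (N choose (2 * k)) * (x ^ (2 * (n - k) + 1) * (1 - x\<^sup>2) ^ k) * (- 1) ^ k"
      \<comment> \<open>For \<open>2 * k > N\<close> the exponent \<open>N - 2 * k\<close> is
        truncated and does not match, but the binomial coefficient is 0.\<close>
      proof (cases "2 * k \<le> N")
        case True
        then have "2 * (n - k) + 1 = p + (N - 2 * k)"
          using N k by (simp add: p_def)
        then show ?thesis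
          unfolding s t[symmetric] by (simp only: power_add mult_ac)
      qed (simp add: binomial_eq_0)
    qed
    finally show ?thesis .
  qed
  ultimately have "(?g has_integral ?L) {0..1}"
    by (rule has_integral_eq[rotated])
  \<comment> \<open>The Beta integral is used with \<open>a = n - k\<close>; then
    \<open>a + k = n\<close> for every \<open>k\<close>, which yields the common factor
    \<open>n + 1\<close> and the denominators \<open>n choose k\<close>.\<close>
  then have "?L = (- 1) ^ N / real N * (\<Sum>k\<le>n. real (N choose (2 * k))
      * (1 / (2 * real (n - k + k + 1) * real ((n - k + k) choose k))) * (- 1) ^ k)"
    by (rule has_integral_unique)
      (intro has_integral_mult_right has_integral_sum has_integral_mult_left has_integral_beta_square; simp)
  also have "\<dots> = ?R"
    unfolding sum_distrib_left by (intro sum.cong refl) (simp add: algebra_simps)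
  finally show ?thesis .
qed

theorem theorem27:
  shows "(\<forall>(n::nat) (m::int). int n + m > 0 \<and> m - 1 \<le> int n \<longrightarrow>
      (\<Sum>j = 0..nat (int n + m). \<Sum>k = 0..nat (int n + m - int j).
          (- 2 :: real) ^ (k + j)
            / (real_of_int (int n + m + int k + int j) * real_of_int (int n - m + int j + 2))
            * real (nat (int n + m + int k + int j) choose nat (int n + m - int k - int j))
            * real ((k + j) choose j))
      = (- 1 :: real) ^ nat (int n + m) / (2 * (real n + 1) * real_of_int (int n + m))
          * (\<Sum>k = 0..n. (- 1 :: real) ^ k
                * (real (nat (int n + m) choose (2 * k)) / real (n choose k))))
    \<and> (\<forall>n::nat. n \<ge> 1 \<longrightarrow>
      (\<Sum>j = 0..n. \<Sum>k = 0..n - j.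
          (- 2 :: real) ^ (k + j) / (real (n + k + j) * real (n + j + 2))
            * real ((n + k + j) choose (n - k - j))
            * real ((k + j) choose j))
      = (- 1 :: real) ^ n / (2 * real n * (real n + 1))
          * (\<Sum>k = 0..n. (- 1 :: real) ^ k
                * (real (n choose (2 * k)) / real (n choose k))))
    \<and> (\<forall>n::nat. n \<ge> 1 \<longrightarrow>
      (\<Sum>j = 0..2 * n. \<Sum>k = 0..2 * n - j.
          (- 2 :: real) ^ (k + j) / (real (2 * n + k + j) * real (j + 2))
            * real ((2 * n + k + j) choose (2 * n - k - j))
            * real ((k + j) choose j))
      = 1 / (4 * real n * (real n + 1))
          * (\<Sum>k = 0..n. (- 1 :: real) ^ k
                * (real ((2 * n) choose (2 * k)) / real (n choose k))))"
proof (intro conjI allI impI, goal_cases)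
  case (1 n m)
  define N where "N = nat (int n + m)"
  have m: "int n + m = int N" and N: "N \<ge> 1" "N \<le> 2 * n + 1"
    using 1 by (auto simp: N_def)
  have "nat (int N - int j) = N - j" "nat (int N + int k + int j) = N + k + j"
      "nat (int N - int k - int j) = N - k - j"
      "real_of_int (int N + int k + int j) = real (N + k + j)"
      "real_of_int (int n - m + int j + 2) = real (2 * n + 2 - N + j)" for j k
    using m N by (auto simp: of_nat_diff nat_diff_distrib nat_add_distrib)
  then show ?case
    unfolding m using cheb_integral_eq[OF N] by (simp only: nat_int atLeast0AtMost of_int_of_nat_eq)
next
  \<comment> \<open>This is \<open>m = 0\<close>, that is \<open>N = n\<close>.\<close>
  case (2 n)
  then have "2 * n + 2 - n + j = n + j + 2" for j by simp
  then show ?case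
    using cheb_integral_eq[of n n] 2 by (simp add: atLeast0AtMost mult_ac)
next
  \<comment> \<open>This is \<open>m = n\<close>, that is \<open>N = 2 * n\<close>; the sign
    \<open>(- 1) ^ N\<close> is then 1.\<close>
  case (3 n)
  then show ?case
    using cheb_integral_eq[of "2 * n" n] by (simp add: atLeast0AtMost mult_ac add.commute)
qed

end
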